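(* The boundary control system is not spectrally controllable in $H^1_0(0,1)\times L^2(0,1)$: for every $T>0$ and every nonzero $U^0=(u_0,v_0)$ belonging to the linear span of finitely many eigenfunctions of $A$ (i.e. of finitely many elements of $\{U_0\}\cup\{U_n:n\in\mathbb{Z}\setminus\{0\}\}$), there is no $h\in H^1(0,T)$ with $h(0)=0$ such that the solution $(u,v)$ of the boundary control system with initial data $(u_0,v_0)$ and control $h$ satisfies $u(\cdot,T)=0$ and $v(\cdot,T)=0$.
   Context: Complex-valued functions. $\mathcal{H}=H^1_0(0,1)\times L^2(0,1)$ with inner product $((u,v),(\varphi,\psi))_{\mathcal{H}}=\int_0^1(u'\overline{\varphi'}+u\overline\varphi)+\int_0^1v\overline\psi$. $(I-\partial_x^2)^{-1}$: inverse of $I-d^2/dx^2$ on $(0,1)$ with homogeneous Dirichlet conditions ($H^{-1}\to H^1_0$). $A(u,v)=(-(I-\partial_x^2)^{-1}\partial_xv,-\partial_xu)$ on $\mathcal{H}$. Its eigenfunctions: $U_0=(0,1)$ (eigenvalue $0$) and $U_n=(\frac{\sin(n\pi x)}{\sqrt{1+n^2\pi^2}},\,i\cos(n\pi x))$ with eigenvalue $\frac{in\pi}{\sqrt{1+n^2\pi^2}}$, $n\in\mathbb{Z}\setminus\{0\}$. Boundary control system: $\partial_tu-\partial_t\partial_x^2u-\partial_xv=0$, $\partial_tv-\partial_xu=0$ on $(0,1)\times(0,T)$, $u(0,t)=0$, $u(1,t)=h(t)$, $(u,v)(\cdot,0)=(u_0,v_0)$; its solution (for $h\in H^1(0,T)$,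 $u_0(1)=h(0)$) is $u=w+xh(t)$, $v=z$, where $W=(w,z)\in C([0,T];\mathcal{H})$, $W(t)=e^{-tA}W_0+\int_0^te^{-(t-\tau)A}F(\tau)d\tau$, $W_0=(u_0-xh(0),v_0)$, $F(t)=(-(I-\partial_x^2)^{-1}(x h'(t)),h(t))$. *)

theory Defs
  imports "HOL-Analysis.Analysis"
begin

text \<open>Complex-valued functions on the interval; only values on the interval matter.\<close>

definition L2_on :: "real \<Rightarrow> real \<Rightarrow> (real \<Rightarrow> complex) \<Rightarrow> bool" where
  "L2_on a b g \<longleftrightarrow> g \<in> borel_measurable (lebesgue_on {a..b}) \<and>
     integrable (lebesgue_on {a..b}) (\<lambda>x. (cmod (g x))^2)"

text \<open>H^1(a,b): (continuous representatives of) functions that are indefinite integrals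
  of an L^2 function (the weak derivative).\<close>
definition H1_on :: "real \<Rightarrow> real \<Rightarrow> (real \<Rightarrow> complex) \<Rightarrow> bool" where
  "H1_on a b u \<longleftrightarrow> (\<exists>g. L2_on a b g \<and>
     (\<forall>x\<in>{a..b}. u x = u a + integral\<^sup>L (lebesgue_on {a..x}) g))"

definition wderiv_on :: "real \<Rightarrow> real \<Rightarrow> (real \<Rightarrow> complex) \<Rightarrow> (real \<Rightarrow> complex)" where
  "wderiv_on a b u = (SOME g. L2_on a b g \<and>
     (\<forall>x\<in>{a..b}. u x = u a + integral\<^sup>L (lebesgue_on {a..x}) g))"

abbreviation L2 :: "(real \<Rightarrow> complex) \<Rightarrow> bool" where "L2 \<equiv> L2_on 0 1"
abbreviation wderiv :: "(real \<Rightarrow> complex) \<Rightarrow> (real \<Rightarrow> complex)" where "wderiv \<equiv> wderiv_on 0 1"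

definition H10 :: "(real \<Rightarrow> complex) \<Rightarrow> bool" where
  "H10 u \<longleftrightarrow> H1_on 0 1 u \<and> u 0 = 0 \<and> u 1 = 0"

definition ipL2 :: "(real \<Rightarrow> complex) \<Rightarrow> (real \<Rightarrow> complex) \<Rightarrow> complex" where
  "ipL2 f g = integral\<^sup>L (lebesgue_on {0..1}) (\<lambda>x. f x * cnj (g x))"

definition ipH1 :: "(real \<Rightarrow> complex) \<Rightarrow> (real \<Rightarrow> complex) \<Rightarrow> complex" where
  "ipH1 u \<phi> = ipL2 (wderiv u) (wderiv \<phi>) + ipL2 u \<phi>"

type_synonym state = "(real \<Rightarrow> complex) \<times> (real \<Rightarrow> complex)"

definition Hspace :: "state set" where
  "Hspace = {(u, v). H10 u \<and> L2 v}"

definition ipH :: "state \<Rightarrow> state \<Rightarrow> complex" where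
  "ipH U \<Phi> = ipH1 (fst U) (fst \<Phi>) + ipL2 (snd U) (snd \<Phi>)"

text \<open>Elements of H^{-1} are represented as (antilinear) functionals on H^1_0.\<close>
definition embL2 :: "(real \<Rightarrow> complex) \<Rightarrow> ((real \<Rightarrow> complex) \<Rightarrow> complex)" where
  "embL2 f = (\<lambda>\<phi>. ipL2 f \<phi>)"

text \<open>Distributional derivative of an L^2 function, as element of H^{-1}.\<close>
definition dx_dual :: "(real \<Rightarrow> complex) \<Rightarrow> ((real \<Rightarrow> complex) \<Rightarrow> complex)" where
  "dx_dual v = (\<lambda>\<phi>. - ipL2 v (wderiv \<phi>))"

text \<open>(I - d^2/dx^2)^{-1} with Dirichlet conditions, H^{-1} to H^1_0 (weak formulation).\<close>
definition resolvent :: "((real \<Rightarrow> complex) \<Rightarrow> complex) \<Rightarrow> (real \<Rightarrow> complex)" where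
  "resolvent L = (SOME w. H10 w \<and> (\<forall>\<phi>. H10 \<phi> \<longrightarrow> ipH1 w \<phi> = L \<phi>))"

definition opA :: "state \<Rightarrow> state" where
  "opA U = ((\<lambda>x. - resolvent (dx_dual (snd U)) x), (\<lambda>x. - wderiv (fst U) x))"

definition eigU :: "int \<Rightarrow> state" where
  "eigU n = (if n = 0 then ((\<lambda>x. 0), (\<lambda>x. 1))
     else ((\<lambda>x. complex_of_real (sin (real_of_int n * pi * x) / sqrt (1 + (real_of_int n * pi)^2))),
           (\<lambda>x. \<i> * complex_of_real (cos (real_of_int n * pi * x)))))"

text \<open>(e^{-sA} X, \<Phi>)_H, with e^{-sA} the exponential series of the bounded operator A.\<close>
definition semigrp_ip :: "real \<Rightarrow> state \<Rightarrow> state \<Rightarrow> complex" where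
  "semigrp_ip s X \<Phi> = (\<Sum>k. complex_of_real ((- s) ^ k / fact k) * ipH ((opA ^^ k) X) \<Phi>)"

definition forcing :: "real \<Rightarrow> (real \<Rightarrow> complex) \<Rightarrow> real \<Rightarrow> state" where
  "forcing T h t = ((\<lambda>x. - resolvent (embL2 (\<lambda>y. complex_of_real y * wderiv_on 0 T h t)) x),
                    (\<lambda>x. h t))"

text \<open>W solves W(t) = e^{-tA} W0 + int_0^t e^{-(t-\<tau>)A} F(\<tau>) d\<tau> in H for t in [0,T]
  (identity in H, tested against all elements of H).\<close>
definition is_solution :: "real \<Rightarrow> (real \<Rightarrow> complex) \<Rightarrow> (real \<Rightarrow> complex) \<Rightarrow> (real \<Rightarrow> complex)
    \<Rightarrow> (real \<Rightarrow> state) \<Rightarrow> bool" where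
  "is_solution T h u0 v0 W \<longleftrightarrow>
     (\<forall>t\<in>{0..T}. W t \<in> Hspace \<and>
        (\<forall>\<Phi>\<in>Hspace. ipH (W t) \<Phi> =
            semigrp_ip t ((\<lambda>x. u0 x - complex_of_real x * h 0), v0) \<Phi>
            + integral {0..t} (\<lambda>\<tau>. semigrp_ip (t - \<tau>) (forcing T h \<tau>) \<Phi>)))"

end

theory Submission
  imports Defs "HOL-Complex_Analysis.Conformal_Mappings" "HOL-Real_Asymp.Real_Asymp"
begin

text \<open>
  The eigenfunctions \<open>U\<^sub>n\<close> are orthonormal, and tested against \<open>U\<^sub>n\<close> the semigroup is
  multiplication by \<open>exp (- \<lambda>\<^sub>n t)\<close>, which makes Duhamel's formula scalar. If the control \<open>h\<close>
  steers the state to zero at time \<open>T\<close>, then \<open>h(T) = 0\<close>, and an integration by parts in time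
  shows that the coefficient of the initial state along \<open>U\<^sub>n\<close> is a nonzero multiple of
  \<open>H(\<lambda>\<^sub>n)\<close>, where \<open>H(z) = \<integral>\<^sub>0\<^sup>T e\<^sup>z\<^sup>t h(t) dt\<close> is entire. Only finitely many coefficients are
  nonzero, so \<open>H\<close> vanishes at all but finitely many \<open>\<lambda>\<^sub>n\<close>. As \<open>A\<close> is bounded, the \<open>\<lambda>\<^sub>n\<close>
  accumulate, namely at \<open>\<i>\<close>; hence \<open>H = 0\<close> and every coefficient is zero.
\<close>

section \<open>Weak derivatives\<close>

definition weak_derivative_on ::
    "real \<Rightarrow> real \<Rightarrow> (real \<Rightarrow> 'a::euclidean_space) \<Rightarrow> (real \<Rightarrow> 'a) \<Rightarrow> bool" where
  "weak_derivative_on a b u g \<longleftrightarrow> integrable (lebesgue_on {a..b}) g \<and>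
     (\<forall>x\<in>{a..b}. u x = u a + integral\<^sup>L (lebesgue_on {a..x}) g)"

lemma weak_derivative_onI:
  assumes "integrable (lebesgue_on {a..b}) g"
    and "\<And>x. x \<in> {a..b} \<Longrightarrow> u x = u a + integral\<^sup>L (lebesgue_on {a..x}) g"
  shows "weak_derivative_on a b u g"
  using assms by (simp only: weak_derivative_on_def) blast

lemma weak_derivative_on_integrable:
  "weak_derivative_on a b u g \<Longrightarrow> integrable (lebesgue_on {a..b}) g"
  by (simp only: weak_derivative_on_def)

lemma weak_derivative_on_integral:
  "weak_derivative_on a b u g \<Longrightarrow> x \<in> {a..b} \<Longrightarrow> integral\<^sup>L (lebesgue_on {a..x}) g = u x - u a"
  unfolding weak_derivative_on_def by (metis add_diff_cancel_left')

lemma weak_derivative_on_subinterval: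
  assumes u: "weak_derivative_on a b u g" and cd: "{c..d} \<subseteq> {a..b}"
  shows "weak_derivative_on c d u g"
proof (rule weak_derivative_onI)
  show "integrable (lebesgue_on {c..d}) g"
    by (rule integrable_subinterval[OF weak_derivative_on_integrable[OF u] cd])
  fix x assume x: "x \<in> {c..d}"
  have "integrable (lebesgue_on {a..x}) g"
    by (rule integrable_subinterval[OF weak_derivative_on_integrable[OF u]]) (use x cd in auto)
  then have "integral\<^sup>L (lebesgue_on {a..x}) g =
      integral\<^sup>L (lebesgue_on {a..c}) g + integral\<^sup>L (lebesgue_on {c..x}) g"
    by (rule Equivalence_Measurable_On_Borel.integral_combine) (use x cd in auto)
  then show "u x = u c + integral\<^sup>L (lebesgue_on {c..x}) g"
    using x cd by (simp add: weak_derivative_on_integral[OF u] subset_iff)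
qed

lemma weak_derivative_on_continuous:
  assumes u: "weak_derivative_on a b u g"
  shows "continuous_on {a..b} u"
proof -
  have "continuous_on {a..b} (\<lambda>x. u a + integral\<^sup>L (lebesgue_on {a..x}) g)"
    by (intro continuous_intros indefinite_integral_continuous_real
        weak_derivative_on_integrable[OF u])
  then show ?thesis
    by (rule continuous_on_eq) (simp add: weak_derivative_on_integral[OF u])
qed

lemma weak_derivative_on_cong:
  assumes u: "weak_derivative_on a b u g"
    and eq: "\<And>x. x \<in> {a..b} \<Longrightarrow> u x = u' x" "\<And>x. x \<in> {a..b} \<Longrightarrow> g x = g' x"
  shows "weak_derivative_on a b u' g'"
proof (rule weak_derivative_onI)
  show "integrable (lebesgue_on {a..b}) g'"
    using weak_derivative_on_integrable[OF u] eq(2)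
    by (subst Bochner_Integration.integrable_cong[where g = g]) auto
  fix x assume x: "x \<in> {a..b}"
  have "integral\<^sup>L (lebesgue_on {a..x}) g' = integral\<^sup>L (lebesgue_on {a..x}) g"
    using x eq(2) by (intro Bochner_Integration.integral_cong) auto
  then show "u' x = u' a + integral\<^sup>L (lebesgue_on {a..x}) g'"
    using x eq(1)[of a] eq(1)[of x] by (simp add: weak_derivative_on_integral[OF u])
qed

lemma weak_derivative_on_add:
  assumes u: "weak_derivative_on a b u g" and v: "weak_derivative_on a b v k"
  shows "weak_derivative_on a b (\<lambda>x. u x + v x) (\<lambda>x. g x + k x)"
proof (rule weak_derivative_onI)
  show "integrable (lebesgue_on {a..b}) (\<lambda>x. g x + k x)"
    using weak_derivative_on_integrable[OF u] weak_derivative_on_integrable[OF v] by simp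
  fix x assume x: "x \<in> {a..b}"
  then have "integrable (lebesgue_on {a..x}) g" "integrable (lebesgue_on {a..x}) k"
    by (auto intro!: weak_derivative_on_integrable[OF weak_derivative_on_subinterval[OF u]]
        weak_derivative_on_integrable[OF weak_derivative_on_subinterval[OF v]])
  then show "u x + v x = u a + v a + (\<integral>x. g x + k x \<partial>lebesgue_on {a..x})"
    using x by (simp add: weak_derivative_on_integral[OF u] weak_derivative_on_integral[OF v])
qed

lemma weak_derivative_on_bounded_linear:
  assumes L: "bounded_linear L" and u: "weak_derivative_on a b u g"
  shows "weak_derivative_on a b (\<lambda>x. L (u x)) (\<lambda>x. L (g x))"
proof (rule weak_derivative_onI)
  show "integrable (lebesgue_on {a..b}) (\<lambda>x. L (g x))"
    by (rule integrable_bounded_linear[OF L weak_derivative_on_integrable[OF u]])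
  fix x assume x: "x \<in> {a..b}"
  then have "integrable (lebesgue_on {a..x}) g"
    by (intro weak_derivative_on_integrable[OF weak_derivative_on_subinterval[OF u]]) auto
  then have "(\<integral>x. L (g x) \<partial>lebesgue_on {a..x}) = L (u x - u a)"
    by (simp add: integral_bounded_linear[OF L] weak_derivative_on_integral[OF u x])
  then show "L (u x) = L (u a) + (\<integral>x. L (g x) \<partial>lebesgue_on {a..x})"
    by (simp add: linear_diff[OF bounded_linear.linear[OF L]])
qed

lemmas weak_derivative_on_cnj = weak_derivative_on_bounded_linear[OF bounded_linear_cnj]

lemma weak_derivative_on_cmult:
  fixes c :: "'a::{real_normed_field, euclidean_space}"
  shows "weak_derivative_on a b u g \<Longrightarrow> weak_derivative_on a b (\<lambda>x. c * u x) (\<lambda>x. c * g x)"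
  by (rule weak_derivative_on_bounded_linear[OF bounded_linear_mult_right])

lemma has_vector_derivative_imp_weak_derivative_on:
  assumes f: "\<And>x. x \<in> {a..b} \<Longrightarrow> (f has_vector_derivative f' x) (at x within {a..b})"
    and f': "continuous_on {a..b} f'"
  shows "weak_derivative_on a b f f'"
proof (rule weak_derivative_onI)
  show int: "integrable (lebesgue_on {a..b}) f'"
    by (rule continuous_imp_integrable_real[OF f'])
  fix x assume x: "x \<in> {a..b}"
  have "(f' has_integral f x - f a) {a..x}"
    using x
    by (intro fundamental_theorem_of_calculus has_vector_derivative_within_subset[OF f]) auto
  moreover have "integrable (lebesgue_on {a..x}) f'"
    by (rule integrable_subinterval[OF int]) (use x in auto)
  ultimately show "f x = f a + integral\<^sup>L (lebesgue_on {a..x}) f'"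
    by (simp add: lebesgue_integral_eq_integral integral_unique)
qed

lemma weak_derivative_on_indefinite_integral:
  assumes "integrable (lebesgue_on {a..b}) g"
  shows "weak_derivative_on a b (\<lambda>x. integral\<^sup>L (lebesgue_on {a..x}) g) g"
proof -
  have "integral\<^sup>L (lebesgue_on {a}) g = 0"
    by (intro has_bochner_integral_integral_eq has_bochner_integral_null) simp
  with assms show ?thesis by (intro weak_derivative_onI) auto
qed

lemma integral_lebesgue_on_Icc_cutoff:
  fixes f :: "real \<Rightarrow> 'a::euclidean_space"
  shows "t \<le> b \<Longrightarrow> (\<integral>s. (if s \<le> t then f s else 0) \<partial>lebesgue_on {a..b}) =
      integral\<^sup>L (lebesgue_on {a..t}) f"
    and "a \<le> t \<Longrightarrow> (\<integral>s. (if t \<le> s then f s else 0) \<partial>lebesgue_on {a..b}) =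
      integral\<^sup>L (lebesgue_on {t..b}) f"
  using Lebesgue_Measure.integral_restrict_Int[of "{..t}" "{a..b}" f]
    Lebesgue_Measure.integral_restrict_Int[of "{t..}" "{a..b}" f]
  by (simp_all add: Int_atLeastAtMostR1 Int_atLeastAtMostR2)

lemma integral_indefinite_integral_mult:
  fixes f g :: "real \<Rightarrow> 'a::{real_normed_field, euclidean_space}"
  assumes f: "integrable (lebesgue_on {a..b}) f" and g: "integrable (lebesgue_on {a..b}) g"
  shows "(\<integral>t. integral\<^sup>L (lebesgue_on {a..t}) f * g t \<partial>lebesgue_on {a..b}) =
    (\<integral>s. f s * integral\<^sup>L (lebesgue_on {s..b}) g \<partial>lebesgue_on {a..b})"
proof -
  let ?M = "lebesgue_on {a..b}"
  interpret finite_measure ?M by (intro finite_measure_lebesgue_on) auto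
  interpret pair_sigma_finite ?M ?M by unfold_locales
  have [measurable]: "f \<in> borel_measurable ?M" "g \<in> borel_measurable ?M"
    using f g by (auto dest: borel_measurable_integrable)
  have [measurable]: "(\<lambda>x. x) \<in> borel_measurable ?M"
    using id_borel_measurable_lebesgue_on unfolding id_def .
  define k where "k s t = (if s \<le> t then f s else 0) * g t" for s t
  have "integrable (?M \<Otimes>\<^sub>M ?M) (\<lambda>(s, t). f s * g t)"
    by (rule Fubini_integrable) (use f g in \<open>auto simp: norm_mult\<close>)
  moreover have "case_prod k \<in> borel_measurable (?M \<Otimes>\<^sub>M ?M)"
    unfolding k_def by measurable
  ultimately have "integrable (?M \<Otimes>\<^sub>M ?M) (case_prod k)"
    by (rule Bochner_Integration.integrable_bound) (auto simp: k_def)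
  then have swap: "(\<integral>t. (\<integral>s. k s t \<partial>?M) \<partial>?M) = (\<integral>s. (\<integral>t. k s t \<partial>?M) \<partial>?M)"
    by (rule Fubini_integral)
  have k_alt: "k = (\<lambda>s t. f s * (if s \<le> t then g t else 0))"
    by (simp add: k_def fun_eq_iff)
  have inner_s: "(\<integral>s. k s t \<partial>?M) = integral\<^sup>L (lebesgue_on {a..t}) f * g t" if "t \<in> {a..b}" for t
    using that by (simp add: k_def integral_lebesgue_on_Icc_cutoff)
  have inner_t: "(\<integral>t. k s t \<partial>?M) = f s * integral\<^sup>L (lebesgue_on {s..b}) g" if "s \<in> {a..b}" for s
    using that by (simp add: k_alt integral_lebesgue_on_Icc_cutoff)
  have "(\<integral>t. integral\<^sup>L (lebesgue_on {a..t}) f * g t \<partial>?M) = (\<integral>t. (\<integral>s. k s t \<partial>?M) \<partial>?M)"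
    by (intro Bochner_Integration.integral_cong) (simp_all add: inner_s)
  also have "\<dots> = (\<integral>s. f s * integral\<^sup>L (lebesgue_on {s..b}) g \<partial>?M)"
    unfolding swap by (intro Bochner_Integration.integral_cong) (simp_all add: inner_t)
  finally show ?thesis .
qed

lemma integrable_mult_continuous:
  fixes f g :: "real \<Rightarrow> 'a::{real_normed_algebra, euclidean_space}"
  assumes f: "continuous_on {a..b} f" and g: "integrable (lebesgue_on {a..b}) g"
  shows "integrable (lebesgue_on {a..b}) (\<lambda>x. f x * g x)"
proof -
  have "bounded (f ` {a..b})"
    by (intro compact_imp_bounded compact_continuous_image f) simp
  moreover have "g absolutely_integrable_on {a..b}"
    using g by (simp add: integrable_restrict_space set_integrable_def)
  ultimately have "(\<lambda>x. f x * g x) absolutely_integrable_on {a..b}"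
    by (intro absolutely_integrable_bounded_measurable_product[OF bilinear_times]
        continuous_imp_measurable_on_sets_lebesgue f) auto
  then show ?thesis by (rule absolutely_integrable_imp_integrable) simp
qed

lemma weak_derivative_on_integral_by_parts:
  fixes u v :: "real \<Rightarrow> 'a::{real_normed_field, euclidean_space}"
  assumes "a \<le> b" and u: "weak_derivative_on a b u g" and v: "weak_derivative_on a b v k"
  shows "(\<integral>x. g x * v x \<partial>lebesgue_on {a..b}) =
    u b * v b - u a * v a - (\<integral>x. u x * k x \<partial>lebesgue_on {a..b})"
proof -
  let ?M = "lebesgue_on {a..b}"
  note int = weak_derivative_on_integrable[OF u] weak_derivative_on_integrable[OF v]
  have uk: "integrable ?M (\<lambda>x. u x * k x)" and vg: "integrable ?M (\<lambda>x. v x * g x)"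
    by (intro integrable_mult_continuous int weak_derivative_on_continuous[OF u]
        weak_derivative_on_continuous[OF v])+
  have total: "integral\<^sup>L ?M g = u b - u a" "integral\<^sup>L ?M k = v b - v a"
    using \<open>a \<le> b\<close> weak_derivative_on_integral[OF u] weak_derivative_on_integral[OF v] by auto
  have tail: "integral\<^sup>L (lebesgue_on {s..b}) k = v b - v s" if "s \<in> {a..b}" for s
    by (rule weak_derivative_on_integral[OF weak_derivative_on_subinterval[OF v, of s b]])
      (use that in auto)
  have "(\<integral>x. u x * k x \<partial>?M) - u a * (v b - v a) = (\<integral>x. (u x - u a) * k x \<partial>?M)"
    using uk int by (simp add: left_diff_distrib total)
  also have "\<dots> = (\<integral>x. integral\<^sup>L (lebesgue_on {a..x}) g * k x \<partial>?M)"
    by (intro Bochner_Integration.integral_cong) (simp_all add: weak_derivative_on_integral[OF u])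
  also have "\<dots> = (\<integral>x. g x * integral\<^sup>L (lebesgue_on {x..b}) k \<partial>?M)"
    by (rule integral_indefinite_integral_mult[OF int])
  also have "\<dots> = (\<integral>x. g x * v b - v x * g x \<partial>?M)"
    by (intro Bochner_Integration.integral_cong) (simp_all add: tail algebra_simps)
  also have "\<dots> = (u b - u a) * v b - (\<integral>x. v x * g x \<partial>?M)"
    using vg int by (simp add: total)
  finally show ?thesis by (simp add: algebra_simps)
qed

lemma weak_derivative_on_mult:
  fixes u v :: "real \<Rightarrow> 'a::{real_normed_field, euclidean_space}"
  assumes u: "weak_derivative_on a b u g" and v: "weak_derivative_on a b v k"
  shows "weak_derivative_on a b (\<lambda>x. u x * v x) (\<lambda>x. g x * v x + u x * k x)"
proof (rule weak_derivative_onI)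
  have int: "integrable (lebesgue_on {a..x}) (\<lambda>x. g x * v x)"
      "integrable (lebesgue_on {a..x}) (\<lambda>x. u x * k x)" if "{a..x} \<subseteq> {a..b}" for x
  proof -
    note u' = weak_derivative_on_subinterval[OF u that]
      and v' = weak_derivative_on_subinterval[OF v that]
    show "integrable (lebesgue_on {a..x}) (\<lambda>x. g x * v x)"
      using integrable_mult_continuous[OF weak_derivative_on_continuous[OF v']
          weak_derivative_on_integrable[OF u']] by (simp add: mult.commute)
    show "integrable (lebesgue_on {a..x}) (\<lambda>x. u x * k x)"
      by (rule integrable_mult_continuous[OF weak_derivative_on_continuous[OF u']
          weak_derivative_on_integrable[OF v']])
  qed
  then show "integrable (lebesgue_on {a..b}) (\<lambda>x. g x * v x + u x * k x)" by simp
  fix x assume x: "x \<in> {a..b}"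
  then have sub: "{a..x} \<subseteq> {a..b}" and "a \<le> x" by auto
  show "u x * v x = u a * v a + (\<integral>x. g x * v x + u x * k x \<partial>lebesgue_on {a..x})"
    using int[OF sub] weak_derivative_on_integral_by_parts[OF \<open>a \<le> x\<close>
        weak_derivative_on_subinterval[OF u sub] weak_derivative_on_subinterval[OF v sub]]
    by simp
qed

text \<open>The library's form of Lebesgue's differentiation theorem recovers \<open>f\<close> almost everywhere
  from its integrals over small cubes.\<close>
lemma negligible_nonzero_if_integral_cbox_eq_0:
  fixes f :: "'a::euclidean_space \<Rightarrow> 'b::euclidean_space"
  assumes f: "\<And>c d. (f has_integral 0) (cbox c d)"
  shows "negligible {x. f x \<noteq> 0}"
proof -
  have "f integrable_on cbox c d" for c d using f by blast
  then obtain N where N: "negligible N"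
    and diff: "\<And>x e. x \<notin> N \<Longrightarrow> 0 < e \<Longrightarrow> \<exists>d>0. \<forall>h. 0 < h \<and> h < d \<longrightarrow>
        norm (integral (cbox x (x + h *\<^sub>R One)) f /\<^sub>R h ^ DIM('a) - f x) < e"
    by (rule integrable_ccontinuous_explicit) blast
  have "f x = 0" if x: "x \<notin> N" for x
  proof (rule ccontr)
    assume "f x \<noteq> 0"
    then obtain d where "d > 0" and d: "\<And>h. 0 < h \<Longrightarrow> h < d \<Longrightarrow>
        norm (integral (cbox x (x + h *\<^sub>R One)) f /\<^sub>R h ^ DIM('a) - f x) < norm (f x)"
      using diff[OF x, of "norm (f x)"] by auto
    then show False using d[of "d / 2"] by (simp add: integral_unique[OF f])
  qed
  then show ?thesis by (intro negligible_subset[OF N]) blast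
qed

lemma weak_derivative_on_zero_imp_AE_zero:
  assumes g: "weak_derivative_on a b (\<lambda>x. 0) g"
  shows "AE x in lebesgue_on {a..b}. g x = 0"
proof -
  let ?g = "\<lambda>x. if x \<in> {a..b} then g x else 0"
  have "(?g has_integral 0) (cbox c d)" for c d
  proof -
    have g': "weak_derivative_on (max a c) (min b d) (\<lambda>x. 0) g"
      by (rule weak_derivative_on_subinterval[OF g]) auto
    have "(g has_integral 0) {max a c..min b d}"
    proof (cases "max a c \<le> min b d")
      case True
      then have "integral\<^sup>L (lebesgue_on {max a c..min b d}) g = 0"
        by (subst weak_derivative_on_integral[OF g']) auto
      then show ?thesis
        using has_integral_integral_lebesgue_on[OF weak_derivative_on_integrable[OF g']] by simp
    qed simp
    then show ?thesis
      using has_integral_restrict_Int[of "{a..b}" g 0 "cbox c d"] by (simp add: Int_atLeastAtMost)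
  qed
  then have "negligible {x. ?g x \<noteq> 0}" by (rule negligible_nonzero_if_integral_cbox_eq_0)
  then have "AE x in lebesgue. \<not> (x \<in> {a..b} \<and> g x \<noteq> 0)"
    unfolding negligible_iff_null_sets by (intro AE_I'[of "{x. ?g x \<noteq> 0}"]) auto
  then show ?thesis by (subst AE_restrict_space_iff) auto
qed

lemma weak_derivative_on_unique_AE:
  assumes "weak_derivative_on a b u g" and "weak_derivative_on a b u g'"
  shows "AE x in lebesgue_on {a..b}. g x = g' x"
proof -
  have "weak_derivative_on a b (\<lambda>x. u x + - u x) (\<lambda>x. g x + - g' x)"
    by (intro weak_derivative_on_add weak_derivative_on_bounded_linear[where L = uminus] assms
        bounded_linear_minus bounded_linear_ident)
  then have "AE x in lebesgue_on {a..b}. g x + - g' x = 0"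
    by (intro weak_derivative_on_zero_imp_AE_zero) simp
  then show ?thesis by eventually_elim simp
qed

lemma weak_linear_ode_solvable:
  fixes v :: "real \<Rightarrow> 'a::{real_normed_field, euclidean_space}"
  assumes v: "integrable (lebesgue_on {a..b}) v"
  obtains p where "p a = 0" and "weak_derivative_on a b p (\<lambda>x. c * p x + v x)"
proof -
  define E where "E l x = exp (x *\<^sub>R l)" for l :: 'a and x
  have E: "weak_derivative_on a b (E l) (\<lambda>x. E l x * l)" for l
    unfolding E_def
    by (intro has_vector_derivative_imp_weak_derivative_on exp_scaleR_has_vector_derivative_right
        continuous_intros)
  have E_inverse: "E c x * E (- c) x = 1" for x by (simp add: E_def flip: exp_add)
  define q where "q x = (\<integral>s. E (- c) s * v s \<partial>lebesgue_on {a..x})" for x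
  have q: "weak_derivative_on a b q (\<lambda>x. E (- c) x * v x)"
    unfolding q_def
    by (intro weak_derivative_on_indefinite_integral integrable_mult_continuous v
        weak_derivative_on_continuous[OF E])
  show thesis
  proof (rule that)
    show "E c a * q a = 0"
      by (simp add: q_def has_bochner_integral_integral_eq[OF has_bochner_integral_null])
    show "weak_derivative_on a b (\<lambda>x. E c x * q x) (\<lambda>x. c * (E c x * q x) + v x)"
    proof (rule weak_derivative_on_cong[OF weak_derivative_on_mult[OF E q]])
      show "E c x * c * q x + E c x * (E (- c) x * v x) = c * (E c x * q x) + v x" for x
        using E_inverse[of x] by (simp flip: mult.assoc)
    qed simp
  qed
qed

lemma weak_derivative_on_cosh_sinh:
  "weak_derivative_on a b (\<lambda>x. of_real (cosh (x - c))) (\<lambda>x. of_real (sinh (x - c)))"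
  "weak_derivative_on a b (\<lambda>x. of_real (sinh (x - c))) (\<lambda>x. of_real (cosh (x - c)))"
  by (intro has_vector_derivative_imp_weak_derivative_on has_vector_derivative_of_real
        continuous_intros;
      auto intro!: derivative_eq_intros)+

text \<open>The sum and the difference of \<open>w\<close> and \<open>y\<close> decouple the system; the multiple of
  \<open>(cosh, sinh)\<close>, which solves the homogeneous system, corrects the boundary value at \<open>b\<close>.\<close>
lemma weak_dirichlet_problem_solvable:
  fixes v :: "real \<Rightarrow> 'a::{real_normed_field, euclidean_space}"
  assumes "a < b" and v: "integrable (lebesgue_on {a..b}) v"
  obtains y w where "weak_derivative_on a b y w" and "weak_derivative_on a b w (\<lambda>x. y x - v x)"
    and "w a = 0" and "w b = 0"
proof -
  have neg_v: "integrable (lebesgue_on {a..b}) (\<lambda>x. - v x)" using v by simp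
  obtain p where p: "p a = 0" "weak_derivative_on a b p (\<lambda>x. 1 * p x + - v x)"
    by (rule weak_linear_ode_solvable[OF neg_v])
  obtain q where q: "q a = 0" "weak_derivative_on a b q (\<lambda>x. - 1 * q x + - v x)"
    by (rule weak_linear_ode_solvable[OF neg_v])
  define k where "k = - (p b + q b) / (2 * of_real (sinh (b - a)))"
  define w where "w x = 1 / 2 * (p x + q x) + k * of_real (sinh (x - a))" for x
  define y where "y x = 1 / 2 * (p x + - 1 * q x) + k * of_real (cosh (x - a))" for x
  have "weak_derivative_on a b y (\<lambda>x. 1 / 2 * ((1 * p x + - v x) + - 1 * (- 1 * q x + - v x))
      + k * of_real (sinh (x - a)))"
    unfolding y_def
    by (intro weak_derivative_on_add weak_derivative_on_cmult p(2) q(2)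
        weak_derivative_on_cosh_sinh)
  then have y': "weak_derivative_on a b y w"
    by (rule weak_derivative_on_cong) (simp_all add: w_def algebra_simps)
  have "weak_derivative_on a b w (\<lambda>x. 1 / 2 * ((1 * p x + - v x) + (- 1 * q x + - v x))
      + k * of_real (cosh (x - a)))"
    unfolding w_def
    by (intro weak_derivative_on_add weak_derivative_on_cmult p(2) q(2)
        weak_derivative_on_cosh_sinh)
  then have w': "weak_derivative_on a b w (\<lambda>x. y x - v x)"
    by (rule weak_derivative_on_cong) (simp_all add: y_def field_simps)
  show thesis
  proof (rule that[OF y' w'])
    show "w a = 0" by (simp add: w_def p q)
    show "w b = 0" using \<open>a < b\<close> by (simp add: w_def k_def field_simps)
  qed
qed

section \<open>Square-integrable functions and the Sobolev space\<close>

lemma L2_on_imp_integrable: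
  assumes "L2_on a b g"
  shows "integrable (lebesgue_on {a..b}) g"
proof -
  interpret finite_measure "lebesgue_on {a..b}" by (intro finite_measure_lebesgue_on) auto
  have [measurable]: "g \<in> borel_measurable (lebesgue_on {a..b})"
    using assms by (simp add: L2_on_def)
  have "integrable (lebesgue_on {a..b}) (\<lambda>x. cmod (g x))"
    by (rule square_integrable_imp_integrable) (use assms in \<open>auto simp: L2_on_def\<close>)
  then show ?thesis by (simp add: integrable_norm_iff)
qed

lemma L2_on_continuous:
  assumes "continuous_on {a..b} g"
  shows "L2_on a b g"
  unfolding L2_on_def using continuous_imp_measurable_on_sets_lebesgue[OF assms] assms
  by (auto intro!: continuous_imp_integrable_real continuous_intros)

lemma L2_on_cmult:
  "L2_on a b f \<Longrightarrow> L2_on a b (\<lambda>x. c * f x)"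
  by (auto simp: L2_on_def norm_mult power_mult_distrib)

lemma borel_measurable_cnj:
  "f \<in> borel_measurable M \<Longrightarrow> (\<lambda>x. cnj (f x)) \<in> borel_measurable M"
  by (rule measurable_compose[OF _ borel_measurable_continuous_onI])
     (auto intro!: continuous_intros)

lemma L2_on_mult_cnj_integrable:
  assumes f: "L2_on a b f" and g: "L2_on a b g"
  shows "integrable (lebesgue_on {a..b}) (\<lambda>x. f x * cnj (g x))"
proof (rule Bochner_Integration.integrable_bound)
  show "integrable (lebesgue_on {a..b}) (\<lambda>x. (cmod (f x))\<^sup>2 + (cmod (g x))\<^sup>2)"
    using f g by (auto simp: L2_on_def)
  show "(\<lambda>x. f x * cnj (g x)) \<in> borel_measurable (lebesgue_on {a..b})"
    using f g by (intro borel_measurable_times borel_measurable_cnj) (auto simp: L2_on_def)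
  have "cmod y * cmod z \<le> (cmod y)\<^sup>2 + (cmod z)\<^sup>2" for y z
    using sum_squares_bound[of "cmod y" "cmod z"]
      mult_nonneg_nonneg[OF norm_ge_zero[of y] norm_ge_zero[of z]]
    by linarith
  then show "AE x in lebesgue_on {a..b}.
      norm (f x * cnj (g x)) \<le> norm ((cmod (f x))\<^sup>2 + (cmod (g x))\<^sup>2)"
    by (auto simp: norm_mult)
qed

lemma L2_on_add:
  assumes f: "L2_on a b f" and g: "L2_on a b g"
  shows "L2_on a b (\<lambda>x. f x + g x)"
  unfolding L2_on_def
proof
  show "(\<lambda>x. f x + g x) \<in> borel_measurable (lebesgue_on {a..b})"
    using f g by (auto simp: L2_on_def)
  have "(cmod (y + z))\<^sup>2 = (cmod y)\<^sup>2 + 2 * Re (y * cnj z) + (cmod z)\<^sup>2" for y z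
    unfolding cmod_power2 by (simp add: power2_eq_square algebra_simps)
  moreover have "integrable (lebesgue_on {a..b})
      (\<lambda>x. (cmod (f x))\<^sup>2 + 2 * Re (f x * cnj (g x)) + (cmod (g x))\<^sup>2)"
    using f g L2_on_mult_cnj_integrable[OF f g]
    by (auto simp: L2_on_def simp del: times_complex.sel)
  ultimately show "integrable (lebesgue_on {a..b}) (\<lambda>x. (cmod (f x + g x))\<^sup>2)"
    by simp
qed

lemma ipL2_cmult_left: "ipL2 (\<lambda>x. c * f x) g = c * ipL2 f g"
  by (simp add: ipL2_def mult.assoc)

lemma ipL2_cmult_right: "ipL2 f (\<lambda>x. c * g x) = cnj c * ipL2 f g"
  by (simp add: ipL2_def mult.left_commute)

lemma ipL2_uminus_left: "ipL2 (\<lambda>x. - f x) g = - ipL2 f g"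
  by (simp add: ipL2_def)

lemma ipL2_diff_left:
  assumes "L2 f" "L2 f'" "L2 g"
  shows "ipL2 (\<lambda>x. f x - f' x) g = ipL2 f g - ipL2 f' g"
  using assms by (simp add: ipL2_def left_diff_distrib L2_on_mult_cnj_integrable)

lemma ipL2_sum_left:
  assumes "\<And>n. n \<in> S \<Longrightarrow> L2 (f n)" "L2 g"
  shows "ipL2 (\<lambda>x. \<Sum>n\<in>S. c n * f n x) g = (\<Sum>n\<in>S. c n * ipL2 (f n) g)"
  using assms
  by (simp add: ipL2_def sum_distrib_right mult.assoc L2_on_mult_cnj_integrable
      Bochner_Integration.integral_sum)

lemma ipL2_cong_AE:
  assumes "L2 f" "L2 g" "L2 f'" "L2 g'"
    and "AE x in lebesgue_on {0..1}. f x = f' x" "AE x in lebesgue_on {0..1}. g x = g' x"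
  shows "ipL2 f g = ipL2 f' g'"
  unfolding ipL2_def
proof (rule integral_cong_AE)
  show "AE x in lebesgue_on {0..1}. f x * cnj (g x) = f' x * cnj (g' x)"
    using assms(5,6) by eventually_elim simp
qed (use assms(1-4) in \<open>auto simp: L2_on_def intro!: borel_measurable_times borel_measurable_cnj\<close>)

lemma ipL2_by_parts:
  assumes u: "weak_derivative_on 0 1 u g" and v: "weak_derivative_on 0 1 v k"
  shows "ipL2 g v = u 1 * cnj (v 1) - u 0 * cnj (v 0) - ipL2 u k"
  unfolding ipL2_def
  by (rule weak_derivative_on_integral_by_parts[OF _ u weak_derivative_on_cnj[OF v]]) simp

lemma H1_on_iff: "H1_on a b u \<longleftrightarrow> (\<exists>g. L2_on a b g \<and> weak_derivative_on a b u g)"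
  unfolding H1_on_def weak_derivative_on_def using L2_on_imp_integrable by blast

lemma H1_on_wderiv_on:
  assumes "H1_on a b u"
  shows "L2_on a b (wderiv_on a b u)" and "weak_derivative_on a b u (wderiv_on a b u)"
proof -
  have "L2_on a b (wderiv_on a b u) \<and>
      (\<forall>x\<in>{a..b}. u x = u a + integral\<^sup>L (lebesgue_on {a..x}) (wderiv_on a b u))"
    unfolding wderiv_on_def using assms unfolding H1_on_def by (rule someI_ex)
  then show "L2_on a b (wderiv_on a b u)" "weak_derivative_on a b u (wderiv_on a b u)"
    unfolding weak_derivative_on_def using L2_on_imp_integrable by blast+
qed

lemma wderiv_on_AE_eq:
  assumes "L2_on a b g" and u: "weak_derivative_on a b u g"
  shows "AE x in lebesgue_on {a..b}. wderiv_on a b u x = g x"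
  using assms by (intro weak_derivative_on_unique_AE[OF H1_on_wderiv_on(2)]) (auto simp: H1_on_iff)

lemma ipH1_eq:
  assumes u: "L2 g" "weak_derivative_on 0 1 u g" and v: "L2 k" "weak_derivative_on 0 1 v k"
  shows "ipH1 u v = ipL2 g k + ipL2 u v"
proof -
  have "H1_on 0 1 u" "H1_on 0 1 v" using u v by (auto simp: H1_on_iff)
  then have "ipL2 (wderiv u) (wderiv v) = ipL2 g k"
    using u v by (intro ipL2_cong_AE wderiv_on_AE_eq H1_on_wderiv_on)
  then show ?thesis by (simp add: ipH1_def)
qed

lemma H10I:
  assumes "L2 g" "weak_derivative_on 0 1 u g" "u 0 = 0" "u 1 = 0"
  shows "H10 u"
  using assms by (auto simp: H10_def H1_on_iff)

lemma H10D:
  assumes "H10 u"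
  shows "L2 (wderiv u)" "weak_derivative_on 0 1 u (wderiv u)" "u 0 = 0" "u 1 = 0"
  using assms H1_on_wderiv_on by (auto simp: H10_def)

lemma H10_add:
  assumes u: "H10 u" and v: "H10 v"
  shows "H10 (\<lambda>x. u x + v x)"
  by (rule H10I[OF L2_on_add weak_derivative_on_add,
        OF H10D(1)[OF u] H10D(1)[OF v] H10D(2)[OF u] H10D(2)[OF v]])
    (simp_all add: H10D[OF u] H10D[OF v])

lemma H10_cmult:
  assumes u: "H10 u"
  shows "H10 (\<lambda>x. c * u x)"
  by (rule H10I[OF L2_on_cmult weak_derivative_on_cmult, OF H10D(1,2)[OF u]])
    (simp_all add: H10D[OF u])

lemma H10_uminus: "H10 u \<Longrightarrow> H10 (\<lambda>x. - u x)"
  using H10_cmult[of u "- 1"] by simp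

lemma H10_sum: "(\<And>n. n \<in> S \<Longrightarrow> H10 (f n)) \<Longrightarrow> H10 (\<lambda>x. \<Sum>n\<in>S. c n * f n x)"
proof (induction S rule: infinite_finite_induct)
  case (insert n S)
  then show ?case by (simp add: H10_add H10_cmult)
qed (auto intro!: H10I[of "\<lambda>x. 0"] L2_on_continuous weak_derivative_onI)

lemma H10_cong:
  assumes u: "H10 u" and eq: "\<And>x. x \<in> {0..1} \<Longrightarrow> u x = u' x"
  shows "H10 u'"
  using H10D[OF u] eq[of 0] eq[of 1]
  by (intro H10I[OF _ weak_derivative_on_cong[OF H10D(2)[OF u] eq refl]]) auto

lemma ipH1_uminus_left:
  assumes "H10 u" "H10 v"
  shows "ipH1 (\<lambda>x. - u x) v = - ipH1 u v"
proof -
  have "ipH1 (\<lambda>x. - 1 * u x) v = ipL2 (\<lambda>x. - 1 * wderiv u x) (wderiv v) + ipL2 (\<lambda>x. - 1 * u x) v"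
    by (rule ipH1_eq[OF L2_on_cmult weak_derivative_on_cmult,
          OF H10D(1,2)[OF assms(1)] H10D(1,2)[OF assms(2)]])
  then show ?thesis by (simp add: ipH1_def ipL2_uminus_left)
qed

section \<open>The resolvent\<close>

lemma dx_dual_eq_ipL2:
  assumes y: "weak_derivative_on 0 1 y y'" and \<phi>: "H10 \<phi>"
  shows "dx_dual y \<phi> = ipL2 y' \<phi>"
  using ipL2_by_parts[OF y H10D(2)[OF \<phi>]] by (simp add: dx_dual_def H10D[OF \<phi>])

lemma dx_dual_representable:
  assumes v: "L2 v"
  shows "\<exists>w. H10 w \<and> (\<forall>\<phi>. H10 \<phi> \<longrightarrow> ipH1 w \<phi> = dx_dual v \<phi>)"
proof -
  obtain y w where y: "weak_derivative_on 0 1 y w"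
    and w: "weak_derivative_on 0 1 w (\<lambda>x. y x - v x)" "w 0 = 0" "w 1 = 0"
    by (rule weak_dirichlet_problem_solvable[OF zero_less_one L2_on_imp_integrable[OF v]])
  have L2_y: "L2 y" by (rule L2_on_continuous[OF weak_derivative_on_continuous[OF y]])
  have L2_w': "L2 (\<lambda>x. y x - v x)"
    using L2_on_add[OF L2_y L2_on_cmult[OF v, of "- 1"]] by simp
  have "ipH1 w \<phi> = dx_dual v \<phi>" if \<phi>: "H10 \<phi>" for \<phi>
  proof -
    have "ipH1 w \<phi> = ipL2 (\<lambda>x. y x - v x) (wderiv \<phi>) + ipL2 w \<phi>"
      by (rule ipH1_eq[OF L2_w' w(1) H10D(1,2)[OF \<phi>]])
    also have "\<dots> = - dx_dual y \<phi> + dx_dual v \<phi> + ipL2 w \<phi>"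
      by (simp add: dx_dual_def ipL2_diff_left L2_y v H10D[OF \<phi>])
    finally show ?thesis by (simp add: dx_dual_eq_ipL2[OF y \<phi>])
  qed
  then show ?thesis using H10I[OF L2_w' w] by blast
qed

lemma resolvent_dx_dual:
  assumes "L2 v"
  shows "H10 (resolvent (dx_dual v))"
    and "H10 \<phi> \<Longrightarrow> ipH1 (resolvent (dx_dual v)) \<phi> = dx_dual v \<phi>"
  using someI_ex[OF dx_dual_representable[OF assms]] unfolding resolvent_def by auto

lemma resolvent_embL2:
  assumes f: "L2 f"
  shows "H10 (resolvent (embL2 f))"
    and "H10 \<phi> \<Longrightarrow> ipH1 (resolvent (embL2 f)) \<phi> = ipL2 f \<phi>"
proof -
  define y where "y x = integral\<^sup>L (lebesgue_on {0..x}) f" for x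
  have y: "weak_derivative_on 0 1 y f"
    unfolding y_def by (rule weak_derivative_on_indefinite_integral[OF L2_on_imp_integrable[OF f]])
  have L2_y: "L2 y" by (rule L2_on_continuous[OF weak_derivative_on_continuous[OF y]])
  have "resolvent (embL2 f) = resolvent (dx_dual y)"
    by (simp add: resolvent_def embL2_def dx_dual_eq_ipL2[OF y] cong: conj_cong)
  then show "H10 (resolvent (embL2 f))"
    and "H10 \<phi> \<Longrightarrow> ipH1 (resolvent (embL2 f)) \<phi> = ipL2 f \<phi>"
    using resolvent_dx_dual[OF L2_y] by (simp_all add: dx_dual_eq_ipL2[OF y])
qed

section \<open>The eigenfunctions\<close>

text \<open>The eigenvalue of \<open>I - d\<^sup>2/dx\<^sup>2\<close> at \<open>sin (n \<pi> x)\<close>.\<close>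
definition helmholtz_eigval :: "int \<Rightarrow> real" where
  "helmholtz_eigval n = 1 + (real_of_int n * pi)\<^sup>2"

definition eigval :: "int \<Rightarrow> complex" where
  "eigval n = \<i> * complex_of_real (real_of_int n * pi / sqrt (helmholtz_eigval n))"

lemma helmholtz_eigval_pos: "helmholtz_eigval n > 0"
  by (simp add: helmholtz_eigval_def add_pos_nonneg)

lemma cnj_eigval: "cnj (eigval n) = - eigval n"
  by (simp add: eigval_def)

lemma helmholtz_eigval_mult_eigval_square:
  "complex_of_real (helmholtz_eigval n) * (eigval n * eigval n) =
    1 - complex_of_real (helmholtz_eigval n)"
proof -
  let ?\<mu> = "helmholtz_eigval n" and ?\<omega> = "real_of_int n * pi / sqrt (helmholtz_eigval n)"
  have "?\<mu> * ?\<omega>\<^sup>2 = ?\<mu> - 1"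
    using helmholtz_eigval_pos[of n] by (simp add: power_divide) (simp add: helmholtz_eigval_def)
  then have "complex_of_real ?\<mu> * (complex_of_real ?\<omega>)\<^sup>2 = complex_of_real ?\<mu> - 1"
    by (metis of_real_1 of_real_diff of_real_mult of_real_power)
  then show ?thesis by (simp add: eigval_def power2_eq_square algebra_simps)
qed

lemma fst_eigU:
  "fst (eigU n) =
    (\<lambda>x. of_real (1 / sqrt (helmholtz_eigval n)) * of_real (sin (real_of_int n * pi * x)))"
  by (simp add: eigU_def helmholtz_eigval_def fun_eq_iff)

lemma snd_eigU:
  "snd (eigU n) = (\<lambda>x. (if n = 0 then 1 else \<i>) * of_real (cos (real_of_int n * pi * x)))"
  by (simp add: eigU_def fun_eq_iff)

lemma snd_eigU_1_neq_0: "snd (eigU n) 1 \<noteq> 0"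
  by (simp add: snd_eigU mult.commute[of _ pi])

lemma weak_derivative_on_sin_cos:
  "weak_derivative_on a b (\<lambda>x. of_real (sin (m * x))) (\<lambda>x. of_real (m * cos (m * x)))"
  "weak_derivative_on a b (\<lambda>x. of_real (cos (m * x))) (\<lambda>x. of_real (- (m * sin (m * x))))"
  by (intro has_vector_derivative_imp_weak_derivative_on has_vector_derivative_of_real
        continuous_intros;
      auto intro!: derivative_eq_intros)+

lemma weak_derivative_on_fst_eigU:
  "weak_derivative_on a b (fst (eigU n)) (\<lambda>x. - eigval n * snd (eigU n) x)"
  unfolding fst_eigU
  by (rule weak_derivative_on_cong,
      rule weak_derivative_on_cmult[OF weak_derivative_on_sin_cos(1)[of a b "real_of_int n * pi"],
        of "of_real (1 / sqrt (helmholtz_eigval n))"])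
     (simp_all add: eigval_def snd_eigU algebra_simps)

lemma weak_derivative_on_snd_eigU:
  "weak_derivative_on a b (snd (eigU n))
     (\<lambda>x. - (eigval n * of_real (helmholtz_eigval n)) * fst (eigU n) x)"
proof -
  let ?m = "real_of_int n * pi" and ?\<mu> = "helmholtz_eigval n"
  have "?m / sqrt ?\<mu> * ?\<mu> = ?m * sqrt ?\<mu>"
    using real_div_sqrt[OF less_imp_le[OF helmholtz_eigval_pos[of n]]]
    by (metis times_divide_eq_left times_divide_eq_right)
  then have "eigval n * of_real ?\<mu> = \<i> * complex_of_real (?m * sqrt ?\<mu>)"
    unfolding eigval_def by (metis mult.assoc of_real_mult)
  then have "- (eigval n * of_real ?\<mu>) * fst (eigU n) x =
      (if n = 0 then 1 else \<i>) * of_real (- (?m * sin (?m * x)))" for x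
    using helmholtz_eigval_pos[of n] by (simp add: fst_eigU)
  then show ?thesis
    unfolding snd_eigU
    using weak_derivative_on_cmult[OF weak_derivative_on_sin_cos(2)[of a b ?m],
        of "if n = 0 then 1 else \<i>"]
    by simp
qed

lemma L2_eigU: "L2 (fst (eigU n))" "L2 (snd (eigU n))"
  by (rule L2_on_continuous[OF weak_derivative_on_continuous[OF weak_derivative_on_fst_eigU]]
      L2_on_continuous[OF weak_derivative_on_continuous[OF weak_derivative_on_snd_eigU]])+

lemma H10_fst_eigU: "H10 (fst (eigU n))"
  by (rule H10I[OF L2_on_cmult[OF L2_eigU(2)] weak_derivative_on_fst_eigU])
     (simp_all add: fst_eigU mult.commute[of _ pi])

lemma eigU_in_Hspace: "eigU n \<in> Hspace"
  by (simp add: Hspace_def case_prod_unfold H10_fst_eigU L2_eigU)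

lemma ipL2_wderiv_snd_eigU:
  assumes u: "H10 u"
  shows "ipL2 (wderiv u) (snd (eigU n)) =
    - eigval n * of_real (helmholtz_eigval n) * ipL2 u (fst (eigU n))"
  using ipL2_by_parts[OF H10D(2)[OF u] weak_derivative_on_snd_eigU]
  by (simp only: ipL2_cmult_right) (simp add: H10D[OF u] cnj_eigval)

lemma ipH1_fst_eigU:
  assumes u: "H10 u"
  shows "ipH1 u (fst (eigU n)) = of_real (helmholtz_eigval n) * ipL2 u (fst (eigU n))"
proof -
  let ?\<mu> = "complex_of_real (helmholtz_eigval n)"
  have "ipH1 u (fst (eigU n)) =
      ipL2 (wderiv u) (\<lambda>x. - eigval n * snd (eigU n) x) + ipL2 u (fst (eigU n))"
    by (rule ipH1_eq[OF H10D(1,2)[OF u] L2_on_cmult[OF L2_eigU(2)] weak_derivative_on_fst_eigU])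
  also have "\<dots> = eigval n * ipL2 (wderiv u) (snd (eigU n)) + ipL2 u (fst (eigU n))"
    by (simp only: ipL2_cmult_right) (simp add: cnj_eigval)
  also have "\<dots> = (1 - ?\<mu> * (eigval n * eigval n)) * ipL2 u (fst (eigU n))"
    by (simp add: ipL2_wderiv_snd_eigU[OF u] algebra_simps)
  finally show ?thesis by (simp add: helmholtz_eigval_mult_eigval_square)
qed

lemma ipH_eigU:
  assumes "X \<in> Hspace"
  shows "ipH X (eigU n) =
    of_real (helmholtz_eigval n) * ipL2 (fst X) (fst (eigU n)) + ipL2 (snd X) (snd (eigU n))"
  using assms by (auto simp: ipH_def Hspace_def ipH1_fst_eigU)

lemma integral_cos_int_pi:
  "(\<integral>x. cos (real_of_int j * pi * x) \<partial>lebesgue_on {0..1}) = of_bool (j = 0)"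
proof (cases "j = 0")
  case False
  let ?m = "real_of_int j * pi"
  have "weak_derivative_on 0 1 (\<lambda>x. 1 / ?m * sin (?m * x)) (\<lambda>x. 1 / ?m * (?m * cos (?m * x)))"
    using weak_derivative_on_cmult[OF weak_derivative_on_sin_cos(1)[of 0 1 ?m], of "1 / ?m"] by simp
  then have "weak_derivative_on 0 1 (\<lambda>x. 1 / ?m * sin (?m * x)) (\<lambda>x. cos (?m * x))"
    by (rule weak_derivative_on_cong) (use False in simp_all)
  then show ?thesis
    using False weak_derivative_on_integral[of 0 1 _ _ 1] by (fastforce simp: mult.commute[of _ pi])
qed (simp add: measure_restrict_space)

lemma ipL2_sin_cos_orthogonal:
  "ipL2 (\<lambda>x. of_real (sin (real_of_int m * pi * x))) (\<lambda>x. of_real (sin (real_of_int n * pi * x))) =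
    (of_bool (m = n) - of_bool (m = - n)) / 2" (is ?sin)
  "ipL2 (\<lambda>x. of_real (cos (real_of_int m * pi * x))) (\<lambda>x. of_real (cos (real_of_int n * pi * x))) =
    (of_bool (m = n) + of_bool (m = - n)) / 2" (is ?cos)
proof -
  have int: "integrable (lebesgue_on {0..1}) (\<lambda>x. cos (real_of_int j * pi * x))" for j
    by (intro continuous_imp_integrable_real continuous_intros)
  have arg: "real_of_int m * pi * x - real_of_int n * pi * x = real_of_int (m - n) * pi * x"
    "real_of_int m * pi * x + real_of_int n * pi * x = real_of_int (m + n) * pi * x" for x
    by (simp_all add: algebra_simps)
  have eq: "m - n = 0 \<longleftrightarrow> m = n" "m + n = 0 \<longleftrightarrow> m = - n" by auto
  show ?sin ?cos
    unfolding ipL2_def complex_cnj_complex_of_real of_real_mult[symmetric]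
      sin_times_sin cos_times_cos arg integral_complex_of_real integral_divide_zero
      Bochner_Integration.integral_diff[OF int int] Bochner_Integration.integral_add[OF int int]
      integral_cos_int_pi eq
    by simp_all
qed

lemma eigU_orthonormal: "ipH (eigU m) (eigU n) = of_bool (m = n)"
proof -
  define scale phase where "scale = (\<lambda>n. complex_of_real (1 / sqrt (helmholtz_eigval n)))"
    and "phase = (\<lambda>n::int. if n = 0 then 1 else \<i>)"
  have "1 / sqrt (helmholtz_eigval k) * (1 / sqrt (helmholtz_eigval k)) * helmholtz_eigval k = 1"
    for k
    using helmholtz_eigval_pos[of k] by simp
  then have scale_square: "scale k * scale k * of_real (helmholtz_eigval k) = 1" for k
    unfolding scale_def by (metis of_real_1 of_real_mult)
  have scale_minus: "scale (- k) = scale k" for k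
    by (simp add: scale_def helmholtz_eigval_def)
  have "ipL2 (fst (eigU m)) (fst (eigU n)) =
      scale m * scale n * ((of_bool (m = n) - of_bool (m = - n)) / 2)"
    unfolding fst_eigU ipL2_cmult_left ipL2_cmult_right ipL2_sin_cos_orthogonal
    by (simp add: scale_def)
  moreover have "ipL2 (snd (eigU m)) (snd (eigU n)) =
      phase m * cnj (phase n) * ((of_bool (m = n) + of_bool (m = - n)) / 2)"
    unfolding snd_eigU ipL2_cmult_left ipL2_cmult_right ipL2_sin_cos_orthogonal
    by (simp add: phase_def)
  ultimately have "ipH (eigU m) (eigU n) =
      of_real (helmholtz_eigval n) *
        (scale m * scale n * ((of_bool (m = n) - of_bool (m = - n)) / 2)) +
      phase m * cnj (phase n) * ((of_bool (m = n) + of_bool (m = - n)) / 2)"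
    by (simp only: ipH_eigU[OF eigU_in_Hspace])
  then show ?thesis
    using scale_square[of n] by (cases "m = n"; cases "m = - n")
      (auto simp: phase_def scale_minus algebra_simps)
qed

lemma ipH_eigU_expansion:
  assumes "finite S"
    and u: "\<And>x. x \<in> {0..1} \<Longrightarrow> u x = (\<Sum>m\<in>S. c m * fst (eigU m) x)"
    and v: "\<And>x. x \<in> {0..1} \<Longrightarrow> v x = (\<Sum>m\<in>S. c m * snd (eigU m) x)"
  shows "(u, v) \<in> Hspace" and "ipH (u, v) (eigU n) = (if n \<in> S then c n else 0)"
proof -
  have "H10 u"
    by (rule H10_cong[OF H10_sum[OF H10_fst_eigU]]) (simp add: u)
  moreover have "continuous_on {0..1} (\<lambda>x. \<Sum>m\<in>S. c m * snd (eigU m) x)"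
    by (intro continuous_intros weak_derivative_on_continuous[OF weak_derivative_on_snd_eigU])
  then have "L2 v" by (rule L2_on_continuous[OF continuous_on_eq[OF _ v[symmetric]]])
  ultimately show X: "(u, v) \<in> Hspace" by (simp add: Hspace_def)
  have "ipL2 u (fst (eigU n)) = ipL2 (\<lambda>x. \<Sum>m\<in>S. c m * fst (eigU m) x) (fst (eigU n))"
    unfolding ipL2_def by (intro Bochner_Integration.integral_cong) (simp_all add: u)
  moreover have "ipL2 v (snd (eigU n)) = ipL2 (\<lambda>x. \<Sum>m\<in>S. c m * snd (eigU m) x) (snd (eigU n))"
    unfolding ipL2_def by (intro Bochner_Integration.integral_cong) (simp_all add: v)
  ultimately have "ipH (u, v) (eigU n) = (\<Sum>m\<in>S. c m * ipH (eigU m) (eigU n))"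
    by (simp add: ipH_eigU[OF X] ipH_eigU[OF eigU_in_Hspace] ipL2_sum_left L2_eigU
        sum_distrib_left sum.distrib algebra_simps)
  also have "\<dots> = (if n \<in> S then c n else 0)"
    using \<open>finite S\<close>
    by (simp add: eigU_orthonormal of_bool_def if_distrib[of "\<lambda>x. _ * x"] cong: if_cong)
  finally show "ipH (u, v) (eigU n) = (if n \<in> S then c n else 0)" .
qed

section \<open>The semigroup and Duhamel's formula in eigenfunction coordinates\<close>

lemma opA_in_Hspace:
  assumes "X \<in> Hspace"
  shows "opA X \<in> Hspace"
proof -
  have "L2 (\<lambda>x. - wderiv (fst X) x)"
    using assms L2_on_cmult[OF H10D(1), of "fst X" "- 1"] by (auto simp: Hspace_def)
  moreover have "H10 (\<lambda>x. - resolvent (dx_dual (snd X)) x)"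
    using assms by (intro H10_uminus resolvent_dx_dual(1)) (auto simp: Hspace_def)
  ultimately show ?thesis by (simp add: Hspace_def opA_def)
qed

lemma ipH_opA_eigU:
  assumes X: "X \<in> Hspace"
  shows "ipH (opA X) (eigU n) = eigval n * ipH X (eigU n)"
proof -
  let ?u = "fst X" and ?v = "snd X" and ?\<phi> = "fst (eigU n)" and ?\<psi> = "snd (eigU n)"
  have u: "H10 ?u" and v: "L2 ?v" using X by (auto simp: Hspace_def)
  have "ipH1 (fst (opA X)) ?\<phi> = - dx_dual ?v ?\<phi>"
    by (simp add: opA_def ipH1_uminus_left resolvent_dx_dual[OF v] H10_fst_eigU)
  also have "\<dots> = ipL2 ?v (wderiv ?\<phi>)"
    by (simp add: dx_dual_def)
  also have "\<dots> = ipL2 ?v (\<lambda>x. - eigval n * ?\<psi> x)"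
    by (intro ipL2_cong_AE v H10D(1)[OF H10_fst_eigU] L2_on_cmult[OF L2_eigU(2)]
        wderiv_on_AE_eq[OF L2_on_cmult[OF L2_eigU(2)] weak_derivative_on_fst_eigU]) simp
  also have "\<dots> = eigval n * ipL2 ?v ?\<psi>"
    by (simp only: ipL2_cmult_right) (simp add: cnj_eigval)
  finally have "ipH1 (fst (opA X)) ?\<phi> = eigval n * ipL2 ?v ?\<psi>" .
  moreover have "ipL2 (snd (opA X)) ?\<psi> = eigval n * ipH1 ?u ?\<phi>"
    by (simp add: opA_def ipL2_uminus_left ipL2_wderiv_snd_eigU[OF u] ipH1_fst_eigU[OF u])
  ultimately show ?thesis by (simp add: ipH_def algebra_simps)
qed

lemma semigrp_ip_eigU:
  assumes X: "X \<in> Hspace"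
  shows "semigrp_ip s X (eigU n) = exp (- (eigval n * of_real s)) * ipH X (eigU n)"
proof -
  have power: "(opA ^^ k) X \<in> Hspace \<and>
      ipH ((opA ^^ k) X) (eigU n) = eigval n ^ k * ipH X (eigU n)" for k
    by (induction k) (auto simp: X opA_in_Hspace ipH_opA_eigU)
  have "(\<lambda>k. (- (eigval n * of_real s)) ^ k /\<^sub>R fact k * ipH X (eigU n)) sums
      (exp (- (eigval n * of_real s)) * ipH X (eigU n))"
    by (intro sums_mult2 exp_converges)
  moreover have "(- (eigval n * of_real s)) ^ k /\<^sub>R fact k * ipH X (eigU n) =
      complex_of_real ((- s) ^ k / fact k) * ipH ((opA ^^ k) X) (eigU n)" for k
  proof -
    have "- (eigval n * of_real s) = complex_of_real (- s) * eigval n" by simp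
    then show ?thesis
      using power[of k]
      by (simp only: power_mult_distrib scaleR_conv_of_real) (simp add: field_simps)
  qed
  ultimately show ?thesis unfolding semigrp_ip_def by (simp add: sums_iff)
qed

lemma forcing_in_Hspace: "forcing T h t \<in> Hspace"
  by (auto simp: Hspace_def forcing_def
      intro!: H10_uminus resolvent_embL2 L2_on_continuous continuous_intros)

lemma ipH_forcing_eigU:
  "ipH (forcing T h t) (eigU n) =
    h t * ipL2 (\<lambda>x. 1) (snd (eigU n)) - wderiv_on 0 T h t * ipL2 of_real (fst (eigU n))"
proof -
  let ?f = "\<lambda>y. complex_of_real y * wderiv_on 0 T h t"
  have f: "L2 ?f" by (intro L2_on_continuous continuous_intros)
  have "ipH1 (\<lambda>x. - resolvent (embL2 ?f) x) (fst (eigU n)) = - ipL2 ?f (fst (eigU n))"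
    by (simp add: ipH1_uminus_left resolvent_embL2[OF f] H10_fst_eigU)
  moreover have "ipL2 ?f (fst (eigU n)) = wderiv_on 0 T h t * ipL2 of_real (fst (eigU n))"
    by (simp add: mult.commute[of "complex_of_real _"] ipL2_cmult_left)
  moreover have "ipL2 (\<lambda>x. h t) (snd (eigU n)) = h t * ipL2 (\<lambda>x. 1) (snd (eigU n))"
    using ipL2_cmult_left[of "h t" "\<lambda>x. 1"] by simp
  ultimately show ?thesis by (simp add: ipH_def forcing_def)
qed

lemma ipH_solution_eigU:
  assumes sol: "is_solution T h u0 v0 W" and t: "t \<in> {0..T}"
    and X: "((\<lambda>x. u0 x - of_real x * h 0), v0) \<in> Hspace"
  shows "ipH (W t) (eigU n) = exp (- (eigval n * of_real t)) *
    (ipH ((\<lambda>x. u0 x - of_real x * h 0), v0) (eigU n) +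
     integral {0..t} (\<lambda>\<tau>. exp (eigval n * of_real \<tau>) * ipH (forcing T h \<tau>) (eigU n)))"
proof -
  let ?e = "exp (- (eigval n * of_real t))"
  have "integral {0..t} (\<lambda>\<tau>. semigrp_ip (t - \<tau>) (forcing T h \<tau>) (eigU n)) =
      integral {0..t} (\<lambda>\<tau>. ?e * (exp (eigval n * of_real \<tau>) * ipH (forcing T h \<tau>) (eigU n)))"
    by (rule integral_cong)
       (simp add: semigrp_ip_eigU[OF forcing_in_Hspace] algebra_simps flip: exp_add)
  also have "\<dots> =
      ?e * integral {0..t} (\<lambda>\<tau>. exp (eigval n * of_real \<tau>) * ipH (forcing T h \<tau>) (eigU n))"
    by (rule integral_mult_right)
  finally show ?thesis
    using sol t by (simp add: is_solution_def eigU_in_Hspace semigrp_ip_eigU[OF X] distrib_left)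
qed

section \<open>Exponential moments of the control\<close>

definition exp_transform :: "real \<Rightarrow> real \<Rightarrow> (real \<Rightarrow> complex) \<Rightarrow> complex \<Rightarrow> complex" where
  "exp_transform a b h z = (\<integral>t. exp (z * of_real t) * h t \<partial>lebesgue_on {a..b})"

lemma exp_transform_integrable:
  fixes h :: "real \<Rightarrow> complex"
  assumes "integrable (lebesgue_on {a..b}) h"
  shows "integrable (lebesgue_on {a..b}) (\<lambda>t. exp (z * of_real t) * h t)"
  using assms by (intro integrable_mult_continuous continuous_intros)

lemma exp_transform_weak_derivative:
  assumes "a \<le> b" and h: "weak_derivative_on a b h g"
  shows "exp_transform a b g z =
    exp (z * of_real b) * h b - exp (z * of_real a) * h a - z * exp_transform a b h z"
proof -
  have "weak_derivative_on a b (\<lambda>t. exp (z * of_real t)) (\<lambda>t. z * exp (z * of_real t))"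
    by (intro has_vector_derivative_imp_weak_derivative_on has_vector_derivative_real_field
        continuous_intros)
       (auto intro!: derivative_eq_intros)
  from weak_derivative_on_integral_by_parts[OF \<open>a \<le> b\<close> this h] show ?thesis
    by (simp add: exp_transform_def mult.assoc)
qed

lemma exp_transform_holomorphic:
  assumes h: "continuous_on {a..b} h"
  shows "exp_transform a b h holomorphic_on UNIV"
proof -
  have "(\<lambda>z. integral (cbox a b) (\<lambda>t. exp (z * of_real t) * h t)) holomorphic_on UNIV"
  proof (rule leibniz_rule_holomorphic)
    show "((\<lambda>z. exp (z * of_real t) * h t) has_field_derivative
        exp (z * of_real t) * of_real t * h t) (at z within UNIV)" for z t
      by (auto intro!: derivative_eq_intros)
    show "(\<lambda>t. exp (z * of_real t) * h t) integrable_on cbox a b" for z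
      using h by (intro integrable_continuous continuous_intros) simp
    show "continuous_on (UNIV \<times> cbox a b) (\<lambda>(z, t). exp (z * of_real t) * of_real t * h t)"
      unfolding case_prod_unfold
      by (intro continuous_intros continuous_on_compose2[OF h]) auto
  qed auto
  then show ?thesis
    by (rule holomorphic_transform)
       (simp add: exp_transform_def lebesgue_integral_eq_integral exp_transform_integrable
        continuous_imp_integrable_real h)
qed

lemma eigval_tendsto_ii: "(\<lambda>k. eigval (int k)) \<longlonglongrightarrow> \<i>"
proof -
  have "(\<lambda>k. real_of_int (int k) * pi / sqrt (helmholtz_eigval (int k))) \<longlonglongrightarrow> 1"
    unfolding helmholtz_eigval_def of_int_of_nat_eq by real_asymp
  from tendsto_mult_left[OF tendsto_of_real[OF this], of \<i>] show ?thesis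
    by (simp add: eigval_def)
qed

lemma eigval_neq_ii: "eigval n \<noteq> \<i>"
proof -
  have "real_of_int n * pi < sqrt (helmholtz_eigval n)"
    unfolding helmholtz_eigval_def by (rule real_less_rsqrt) simp
  then show ?thesis by (auto simp: eigval_def complex_eq_iff)
qed

lemma ii_islimpt_eigval:
  assumes "finite S"
  shows "\<i> islimpt (eigval ` (- S))"
proof -
  have "\<i> islimpt range eigval"
    unfolding islimpt_sequential
    by (intro exI[of _ "\<lambda>k. eigval (int k)"]) (simp add: eigval_tendsto_ii eigval_neq_ii)
  also have "range eigval = eigval ` S \<union> eigval ` (- S)" by blast
  finally show ?thesis using assms by (simp add: islimpt_Un_finite)
qed

lemma exp_transform_eq_0_if_eq_0_at_eigvals:
  assumes h: "continuous_on {a..b} h" and "finite S"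
    and zero: "\<And>n. n \<notin> S \<Longrightarrow> exp_transform a b h (eigval n) = 0"
  shows "exp_transform a b h z = 0"
  by (rule analytic_continuation[OF exp_transform_holomorphic[OF h] _ _ _ _
        ii_islimpt_eigval[OF \<open>finite S\<close>]])
     (use zero in auto)

lemma eigU_boundary_trace:
  "eigval n * ipL2 of_real (fst (eigU n)) + ipL2 (\<lambda>x. 1) (snd (eigU n)) =
    cnj (snd (eigU n) 1) / of_real (helmholtz_eigval n)"
proof -
  let ?\<mu> = "complex_of_real (helmholtz_eigval n)"
  let ?\<alpha> = "ipL2 of_real (fst (eigU n))" and ?\<beta> = "ipL2 (\<lambda>x. 1) (snd (eigU n))"
  have one: "weak_derivative_on 0 1 (\<lambda>x. 1) (\<lambda>x. 0)"
    and id: "weak_derivative_on 0 1 complex_of_real (\<lambda>x. 1)"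
    by (intro has_vector_derivative_imp_weak_derivative_on; auto intro!: derivative_eq_intros)+
  have "0 = - ipL2 (\<lambda>x. 1) (\<lambda>x. - eigval n * snd (eigU n) x)"
    using ipL2_by_parts[OF one weak_derivative_on_fst_eigU]
    by (simp add: H10D[OF H10_fst_eigU] ipL2_def)
  then have mean: "eigval n * ?\<beta> = 0"
    by (simp only: ipL2_cmult_right) (simp add: cnj_eigval)
  have "?\<beta> = cnj (snd (eigU n) 1) - ipL2 of_real (\<lambda>x. - (eigval n * ?\<mu>) * fst (eigU n) x)"
    using ipL2_by_parts[OF id weak_derivative_on_snd_eigU] by simp
  also have "\<dots> = cnj (snd (eigU n) 1) - eigval n * ?\<mu> * ?\<alpha>"
    by (simp only: ipL2_cmult_right) (simp add: cnj_eigval)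
  finally have "?\<mu> * (eigval n * ?\<alpha> + ?\<beta>) = cnj (snd (eigU n) 1) - (1 - ?\<mu>) * ?\<beta>"
    by (simp add: algebra_simps)
  also have "(1 - ?\<mu>) * ?\<beta> = 0"
    using mean by (simp flip: helmholtz_eigval_mult_eigval_square)
  finally show ?thesis
    using helmholtz_eigval_pos[of n] by (simp add: field_simps)
qed

lemma forcing_moment:
  assumes "0 \<le> T" and h: "H1_on 0 T h" "h 0 = 0" "h T = 0"
  shows "integral {0..T} (\<lambda>t. exp (eigval n * of_real t) * ipH (forcing T h t) (eigU n)) =
    cnj (snd (eigU n) 1) / of_real (helmholtz_eigval n) * exp_transform 0 T h (eigval n)"
proof -
  let ?e = "\<lambda>t. exp (eigval n * complex_of_real t)" and ?h' = "wderiv_on 0 T h"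
  let ?\<alpha> = "ipL2 of_real (fst (eigU n))" and ?\<beta> = "ipL2 (\<lambda>x. 1) (snd (eigU n))"
  let ?H = "exp_transform 0 T h (eigval n)"
  have h': "weak_derivative_on 0 T h ?h'" by (rule H1_on_wderiv_on(2)[OF h(1)])
  have int: "integrable (lebesgue_on {0..T}) (\<lambda>t. ?e t * h t)"
      "integrable (lebesgue_on {0..T}) (\<lambda>t. ?e t * ?h' t)"
    by (intro exp_transform_integrable weak_derivative_on_integrable[OF h']
        continuous_imp_integrable_real weak_derivative_on_continuous[OF h'])+
  have "integral {0..T} (\<lambda>t. ?e t * ipH (forcing T h t) (eigU n)) =
      integral {0..T} (\<lambda>t. ?e t * h t * ?\<beta> - ?e t * ?h' t * ?\<alpha>)"
    by (simp add: ipH_forcing_eigU algebra_simps)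
  also have "\<dots> = (\<integral>t. ?e t * h t * ?\<beta> - ?e t * ?h' t * ?\<alpha> \<partial>lebesgue_on {0..T})"
    using int by (intro lebesgue_integral_eq_integral[symmetric]) auto
  also have "\<dots> = ?H * ?\<beta> - exp_transform 0 T ?h' (eigval n) * ?\<alpha>"
    using int by (simp add: exp_transform_def)
  also have "exp_transform 0 T ?h' (eigval n) = - (eigval n * ?H)"
    using exp_transform_weak_derivative[OF \<open>0 \<le> T\<close> h'] h by simp
  also have "?H * ?\<beta> - - (eigval n * ?H) * ?\<alpha> = (eigval n * ?\<alpha> + ?\<beta>) * ?H"
    by (simp add: algebra_simps)
  finally show ?thesis by (simp only: eigU_boundary_trace)
qed

lemma null_control_moment:
  assumes "T > 0" and h: "H1_on 0 T h" "h 0 = 0" and X: "(u0, v0) \<in> Hspace"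
    and sol: "is_solution T h u0 v0 W"
    and u: "\<forall>x\<in>{0..1}. fst (W T) x + of_real x * h T = 0"
    and v: "AE x in lebesgue_on {0..1}. snd (W T) x = 0"
  shows "ipH (u0, v0) (eigU n) =
    - (cnj (snd (eigU n) 1) / of_real (helmholtz_eigval n) * exp_transform 0 T h (eigval n))"
proof -
  have W: "W T \<in> Hspace" using sol \<open>T > 0\<close> by (simp add: is_solution_def)
  then have "h T = 0" using bspec[OF u, of 1] by (auto simp: Hspace_def dest: H10D)
  have "ipL2 (fst (W T)) (fst (eigU n)) = 0"
    unfolding ipL2_def by (rule integral_eq_zero_AE) (use u \<open>h T = 0\<close> in \<open>auto intro: AE_I2\<close>)
  moreover have "ipL2 (snd (W T)) (snd (eigU n)) = 0"
    unfolding ipL2_def by (rule integral_eq_zero_AE) (use v in eventually_elim, simp)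
  ultimately have "0 = ipH (W T) (eigU n)" by (simp add: ipH_eigU[OF W])
  also have "\<dots> = exp (- (eigval n * of_real T)) * (ipH (u0, v0) (eigU n) +
      integral {0..T} (\<lambda>\<tau>. exp (eigval n * of_real \<tau>) * ipH (forcing T h \<tau>) (eigU n)))"
    using ipH_solution_eigU[OF sol, of T] X \<open>h 0 = 0\<close> \<open>T > 0\<close> by simp
  finally show ?thesis
    using forcing_moment[OF _ h \<open>h T = 0\<close>] \<open>T > 0\<close> by (simp add: add_eq_0_iff2)
qed

theorem theorem1p3:
  fixes T :: real and u0 v0 :: "real \<Rightarrow> complex" and S :: "int set" and c :: "int \<Rightarrow> complex"
  assumes "T > 0"
    and "finite S"
    and "\<forall>x\<in>{0..1}. u0 x = (\<Sum>n\<in>S. c n * fst (eigU n) x) \<and> v0 x = (\<Sum>n\<in>S. c n * snd (eigU n) x)"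
    and "\<not> ((\<forall>x\<in>{0..1}. u0 x = 0) \<and> (AE x in lebesgue_on {0..1}. v0 x = 0))"
  shows "\<not> (\<exists>h W. H1_on 0 T h \<and> h 0 = 0 \<and> is_solution T h u0 v0 W \<and>
            (\<forall>x\<in>{0..1}. fst (W T) x + complex_of_real x * h T = 0) \<and>
            (AE x in lebesgue_on {0..1}. snd (W T) x = 0))"
proof safe
  fix h W
  assume h: "H1_on 0 T h" "h 0 = 0" and sol: "is_solution T h u0 v0 W"
    and final: "\<forall>x\<in>{0..1}. fst (W T) x + complex_of_real x * h T = 0"
      "AE x in lebesgue_on {0..1}. snd (W T) x = 0"
  have U0: "(u0, v0) \<in> Hspace" and coeff: "ipH (u0, v0) (eigU n) = (if n \<in> S then c n else 0)" for n
    using ipH_eigU_expansion[OF assms(2)] assms(3) by blast+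
  note moment = null_control_moment[OF assms(1) h U0 sol final, unfolded coeff]
  have h_cont: "continuous_on {0..T} h"
    by (rule weak_derivative_on_continuous[OF H1_on_wderiv_on(2)[OF h(1)]])
  have "exp_transform 0 T h (eigval n) = 0" if "n \<notin> S" for n
    using moment[of n] that helmholtz_eigval_pos[of n] by (simp add: snd_eigU_1_neq_0)
  then have "exp_transform 0 T h z = 0" for z
    by (rule exp_transform_eq_0_if_eq_0_at_eigvals[OF h_cont assms(2)])
  then have "c n = 0" if "n \<in> S" for n
    using moment[of n] that by simp
  then show False using assms(3,4) by (auto intro!: AE_I2)
qed

end
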